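(* Let $\kappa_r>0$, $0<\kappa_\varepsilon<1$, and let $x^*\in\mathbb{R}^2$ be any goal position. For every initial unicycle state $(x_0,\theta_0)\in\mathbb{R}^2\times[-\pi,\pi)$, the closed-loop trajectory $(x(t),\theta(t))$, $t\ge 0$, of the unicycle dynamics under the adaptive headway controller $u_{x^*}=(v_{x^*},\omega_{x^*})$ starting at $(x(0),\theta(0))=(x_0,\theta_0)$ satisfies $$\lim_{t\to\infty}x(t)=x^*.$$
   Context: Write $o(\theta)=(\cos\theta,\sin\theta)^{\mathrm T}$ and $n(\theta)=(-\sin\theta,\cos\theta)^{\mathrm T}$. A unicycle state is $(x,\theta)$ with position $x\in\mathbb{R}^2$ and orientation angle $\theta\in[-\pi,\pi)$ (an angle, understood modulo $2\pi$). The unicycle dynamics are $\dot x=v\,o(\theta)$, $\dot\theta=\omega$, with scalar inputs $v,\omega$. The adaptive headway controller with gains $\kappa_r>0$, $0<\kappa_\varepsilon<1$ towards the goal $x^*$ is, for $x\neq x^*$, $$v_{x^*}(x,\theta)=\frac{\kappa_r\|x^*-x\|\left(o(\theta)^{\mathrm T}\frac{x^*-x}{\|x^*-x\|}-\kappa_\varepsilon\right)}{1-\kappa_\varepsilon\, o(\theta)^{\mathrm T}\frac{x^*-x}{\|x^*-x\|}},\qquad \omega_{x^*}(x,\theta)=\frac{\kappa_r}{\kappa_\varepsilon}\,n(\theta)^{\mathrm T}\frac{x^*-x}{\|x^*-x\|},$$ and $v_{x^*}=\omega_{x^*}=0$ when $x=x^*$. The closed-loop trajectory is the solution of $\dot x=v_{x^*}(x,\theta)\,o(\theta)$,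 $\dot\theta=\omega_{x^*}(x,\theta)$ for $t\ge0$. $\|\cdot\|$ is the Euclidean norm. *)

theory Defs
  imports "HOL-Analysis.Analysis"
begin

definition heading :: "real \<Rightarrow> real ^ 2" where
  "heading \<theta> = vector [cos \<theta>, sin \<theta>]"

definition heading_normal :: "real \<Rightarrow> real ^ 2" where
  "heading_normal \<theta> = vector [- sin \<theta>, cos \<theta>]"

definition goal_direction :: "real ^ 2 \<Rightarrow> real ^ 2 \<Rightarrow> real ^ 2" where
  "goal_direction xg x = (xg - x) /\<^sub>R norm (xg - x)"

definition headway_linear_velocity ::
    "real \<Rightarrow> real \<Rightarrow> real ^ 2 \<Rightarrow> real ^ 2 \<Rightarrow> real \<Rightarrow> real" where
  "headway_linear_velocity \<kappa>r \<kappa>\<epsilon> xg x \<theta> =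
     (if x = xg then 0
      else (\<kappa>r * norm (xg - x) * (heading \<theta> \<bullet> goal_direction xg x - \<kappa>\<epsilon>))
           / (1 - \<kappa>\<epsilon> * (heading \<theta> \<bullet> goal_direction xg x)))"

definition headway_angular_velocity ::
    "real \<Rightarrow> real \<Rightarrow> real ^ 2 \<Rightarrow> real ^ 2 \<Rightarrow> real \<Rightarrow> real" where
  "headway_angular_velocity \<kappa>r \<kappa>\<epsilon> xg x \<theta> =
     (if x = xg then 0
      else \<kappa>r / \<kappa>\<epsilon> * (heading_normal \<theta> \<bullet> goal_direction xg x))"

text \<open>
  Trajectories are classical solutions on the whole half-line, with the one-sided derivative
  at time 0. The orientation angle along a trajectory is represented by its continuous
  real-valued lift, so it may leave the interval from \<open>- pi\<close> to \<open>pi\<close>; the dynamics depend on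
  the angle only modulo \<open>2 * pi\<close>.
\<close>

definition unicycle_trajectory ::
    "(real ^ 2 \<Rightarrow> real \<Rightarrow> real) \<Rightarrow> (real ^ 2 \<Rightarrow> real \<Rightarrow> real) \<Rightarrow>
     real ^ 2 \<Rightarrow> real \<Rightarrow> (real \<Rightarrow> real ^ 2) \<Rightarrow> (real \<Rightarrow> real) \<Rightarrow> bool" where
  "unicycle_trajectory v \<omega> x0 \<theta>0 x \<theta> \<longleftrightarrow>
     x 0 = x0 \<and> \<theta> 0 = \<theta>0 \<and>
     (\<forall>t\<ge>0.
        (x has_vector_derivative v (x t) (\<theta> t) *\<^sub>R heading (\<theta> t)) (at t within {0..}) \<and>
        (\<theta> has_real_derivative \<omega> (x t) (\<theta> t)) (at t within {0..}))"

end

theory Submission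
  imports Defs "HOL-Real_Asymp.Real_Asymp"
begin

text \<open>
  Write \<open>e = xg - x\<close>, \<open>R = e \<bullet> e\<close> and let \<open>c\<close> be the cosine of the angle between the heading and
  \<open>e\<close>. In these coordinates the closed loop decouples:
  \<open>R' = - 2 \<kappa>r R c (c - \<kappa>\<epsilon>) / (1 - \<kappa>\<epsilon> c)\<close> and
  \<open>c' = \<kappa>r (1 - c\<^sup>2) (1 + \<kappa>\<epsilon>\<^sup>2 - 2 \<kappa>\<epsilon> c) / (\<kappa>\<epsilon> (1 - \<kappa>\<epsilon> c))\<close>.
  Since \<open>\<bar>R'\<bar> \<le> K R\<close>, the goal is neither reached nor left in finite time. If \<open>c\<close> starts at \<open>-1\<close>
  it stays there and \<open>R' = - 2 \<kappa>r R\<close>; otherwise \<open>1 - c\<close> decays exponentially, so eventually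
  \<open>R' \<le> - \<kappa>r R\<close>. Either way \<open>R\<close> tends to \<open>0\<close>.
\<close>

section \<open>Gronwall comparison with an exponential\<close>

lemma exp_bound_of_deriv_le:
  fixes f f' :: "real \<Rightarrow> real"
  assumes deriv: "\<And>s. a \<le> s \<Longrightarrow> (f has_real_derivative f' s) (at s within {a..})"
    and le: "\<And>s. a \<le> s \<Longrightarrow> f' s \<le> k * f s"
    and "a \<le> t"
  shows "f t \<le> f a * exp (k * (t - a))"
proof -
  \<comment> \<open>Integrating factor: \<open>f' \<le> k * f\<close> says exactly that
    \<open>h\<close> has a nonpositive derivative.\<close>
  define h where "h s = f s * exp (- k * (s - a))" for s
  have h': "(h has_real_derivative (f' s - k * f s) * exp (- k * (s - a))) (at s within {a..t})"
    if "a \<le> s" for s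
    unfolding h_def
    by (rule derivative_eq_intros DERIV_subset[OF deriv[OF that]] refl | force simp: algebra_simps)+
  have "h t \<le> h a"
  \<comment> \<open>The derivative at \<open>a\<close> is only one-sided, so the mean value argument
    uses two-sided derivatives in the interior and mere continuity at the endpoints.\<close>
  proof (rule DERIV_nonpos_imp_decreasing_open [OF \<open>a \<le> t\<close>])
    fix s assume s: "a < s" "s < t"
    have "(h has_real_derivative (f' s - k * f s) * exp (- k * (s - a))) (at s)"
      using h'[of s] s by (simp add: at_within_Icc_at)
    moreover have "(f' s - k * f s) * exp (- k * (s - a)) \<le> 0"
      using le[of s] s by (simp add: mult_le_0_iff)
    ultimately show "\<exists>y. DERIV h s :> y \<and> y \<le> 0" by blast
  next
    show "continuous_on {a..t} h"
      using h' by (intro DERIV_continuous_on) auto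
  qed
  then have "h t * exp (k * (t - a)) \<le> h a * exp (k * (t - a))"
    by (rule mult_right_mono) simp
  then show ?thesis
    by (simp add: h_def mult.assoc flip: exp_add)
qed

lemma exp_bound_of_deriv_ge:
  fixes f f' :: "real \<Rightarrow> real"
  assumes "\<And>s. a \<le> s \<Longrightarrow> (f has_real_derivative f' s) (at s within {a..})"
    and "\<And>s. a \<le> s \<Longrightarrow> k * f s \<le> f' s"
    and "a \<le> t"
  shows "f a * exp (k * (t - a)) \<le> f t"
proof -
  have "- f t \<le> - f a * exp (k * (t - a))"
    by (rule exp_bound_of_deriv_le[OF DERIV_minus[OF assms(1)]]) (use assms in auto)
  then show ?thesis by simp
qed

section \<open>The heading frame and bounds on the scalar rates\<close>

lemma inner_heading: "heading \<phi> \<bullet> w = cos \<phi> * w $ 1 + sin \<phi> * w $ 2"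
  by (simp add: heading_def inner_vec_def sum_2)

lemma inner_heading_normal: "heading_normal \<phi> \<bullet> w = cos \<phi> * w $ 2 - sin \<phi> * w $ 1"
  by (simp add: heading_normal_def inner_vec_def sum_2)

text \<open>The heading and its normal form an orthonormal basis of the plane, so this is
  Pythagoras. It later turns the squared normal component of the offset into
  \<open>1 - c\<^sup>2\<close>.\<close>

lemma inner_heading_square_sum:
  "(heading \<phi> \<bullet> w)\<^sup>2 + (heading_normal \<phi> \<bullet> w)\<^sup>2 = w \<bullet> w"
proof -
  have "(heading \<phi> \<bullet> w)\<^sup>2 + (heading_normal \<phi> \<bullet> w)\<^sup>2
      = ((cos \<phi>)\<^sup>2 + (sin \<phi>)\<^sup>2) * ((w $ 1)\<^sup>2 + (w $ 2)\<^sup>2)"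
    unfolding inner_heading inner_heading_normal by algebra
  then show ?thesis
    by (simp add: inner_vec_def sum_2 power2_eq_square)
qed

definition bearing_cos :: "real ^ 2 \<Rightarrow> real ^ 2 \<Rightarrow> real \<Rightarrow> real" where
  "bearing_cos xg x \<theta> = heading \<theta> \<bullet> goal_direction xg x"

text \<open>Scaled by \<open>\<kappa>r\<close>, this is the exponential decay rate of the distance
  to the goal. It is negative for \<open>0 < c < \<kappa>\<epsilon>\<close>: the distance may grow
  for a while, so it cannot serve as a Lyapunov function by itself.\<close>

definition radial_rate :: "real \<Rightarrow> real \<Rightarrow> real" where
  "radial_rate \<kappa>\<epsilon> c = c * (c - \<kappa>\<epsilon>) / (1 - \<kappa>\<epsilon> * c)"

text \<open>This is \<open>1 / \<kappa>\<epsilon> - (c - \<kappa>\<epsilon>) / (1 -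
  \<kappa>\<epsilon> * c)\<close> over a common denominator: the effect of turning minus that of
  translating.\<close>

definition alignment_rate :: "real \<Rightarrow> real \<Rightarrow> real" where
  "alignment_rate \<kappa>\<epsilon> c = (1 + \<kappa>\<epsilon>\<^sup>2 - 2 * \<kappa>\<epsilon> * c) / (\<kappa>\<epsilon> * (1 - \<kappa>\<epsilon> * c))"

lemma bearing_cos_bounds: "- 1 \<le> bearing_cos xg x \<theta>" "bearing_cos xg x \<theta> \<le> 1"
proof -
  have n: "norm (heading \<theta>) = 1"
    using inner_heading[of \<theta> "heading \<theta>"]
    by (simp add: heading_def norm_eq_1 flip: power2_eq_square)
  have "norm (goal_direction xg x) \<le> 1"
    \<comment> \<open>At the goal the direction is \<open>0\<close>, because the inverse of
      \<open>0\<close> is \<open>0\<close>; hence an inequality that holds everywhere.\<close>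
    by (cases "x = xg") (simp_all add: goal_direction_def)
  then have "\<bar>bearing_cos xg x \<theta>\<bar> \<le> 1"
    using Cauchy_Schwarz_ineq2[of "heading \<theta>" "goal_direction xg x"] n
    unfolding bearing_cos_def by simp
  then show "- 1 \<le> bearing_cos xg x \<theta>" "bearing_cos xg x \<theta> \<le> 1" by auto
qed

lemma headway_denominator_bounds:
  fixes \<kappa>\<epsilon> c :: real
  assumes "0 < \<kappa>\<epsilon>" "\<kappa>\<epsilon> < 1" "- 1 \<le> c" "c \<le> 1"
  shows "1 - \<kappa>\<epsilon> \<le> 1 - \<kappa>\<epsilon> * c" "1 - \<kappa>\<epsilon> * c \<le> 1 + \<kappa>\<epsilon>"
  using mult_left_mono[of c 1 \<kappa>\<epsilon>] mult_left_mono[of "-1" c \<kappa>\<epsilon>] assms by auto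

lemma radial_rate_bound:
  assumes "0 < \<kappa>\<epsilon>" "\<kappa>\<epsilon> < 1" "- 1 \<le> c" "c \<le> 1"
  shows "\<bar>radial_rate \<kappa>\<epsilon> c\<bar> \<le> 2 / (1 - \<kappa>\<epsilon>)"
proof -
  have "\<bar>c * (c - \<kappa>\<epsilon>)\<bar> \<le> 1 * 2"
    unfolding abs_mult using assms by (intro mult_mono) auto
  moreover have "0 < 1 - \<kappa>\<epsilon>" "1 - \<kappa>\<epsilon> \<le> \<bar>1 - \<kappa>\<epsilon> * c\<bar>"
    using headway_denominator_bounds(1)[OF assms] assms(2) by linarith+
  ultimately show ?thesis
    unfolding radial_rate_def abs_divide by (intro frac_le) auto
qed

text \<open>Numerator and denominator are affine in \<open>c\<close>, so each lies between its
  values at \<open>c = 1\<close> and \<open>c = - 1\<close>; bounding them separately is crude but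
  gives positive constants.\<close>

lemma alignment_rate_bounds:
  assumes "0 < \<kappa>\<epsilon>" "\<kappa>\<epsilon> < 1" "- 1 \<le> c" "c \<le> 1"
  shows "(1 - \<kappa>\<epsilon>)\<^sup>2 / (\<kappa>\<epsilon> * (1 + \<kappa>\<epsilon>)) \<le> alignment_rate \<kappa>\<epsilon> c"
    and "alignment_rate \<kappa>\<epsilon> c \<le> (1 + \<kappa>\<epsilon>)\<^sup>2 / (\<kappa>\<epsilon> * (1 - \<kappa>\<epsilon>))"
proof -
  note b = headway_denominator_bounds[OF assms]
  have n: "(1 - \<kappa>\<epsilon>)\<^sup>2 \<le> 1 + \<kappa>\<epsilon>\<^sup>2 - 2 * \<kappa>\<epsilon> * c" "1 + \<kappa>\<epsilon>\<^sup>2 - 2 * \<kappa>\<epsilon> * c \<le> (1 + \<kappa>\<epsilon>)\<^sup>2"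
    using b by (simp_all add: power2_eq_square algebra_simps)
  have "0 < 1 - \<kappa>\<epsilon> * c" using b(1) assms(2) by linarith
  then have d: "0 < \<kappa>\<epsilon> * (1 - \<kappa>\<epsilon> * c)" "\<kappa>\<epsilon> * (1 - \<kappa>\<epsilon> * c) \<le> \<kappa>\<epsilon> * (1 + \<kappa>\<epsilon>)"
    "\<kappa>\<epsilon> * (1 - \<kappa>\<epsilon>) \<le> \<kappa>\<epsilon> * (1 - \<kappa>\<epsilon> * c)" "0 < \<kappa>\<epsilon> * (1 - \<kappa>\<epsilon>)"
    using b assms(1,2) by (simp_all only: mult_pos_pos mult_left_mono less_imp_le diff_gt_0_iff_gt)
  have pos: "0 \<le> 1 + \<kappa>\<epsilon>\<^sup>2 - 2 * \<kappa>\<epsilon> * c"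
    using n(1) zero_le_power2[of "1 - \<kappa>\<epsilon>"] by linarith
  show "(1 - \<kappa>\<epsilon>)\<^sup>2 / (\<kappa>\<epsilon> * (1 + \<kappa>\<epsilon>)) \<le> alignment_rate \<kappa>\<epsilon> c"
    unfolding alignment_rate_def by (rule frac_le[OF pos n(1) d(1,2)])
  show "alignment_rate \<kappa>\<epsilon> c \<le> (1 + \<kappa>\<epsilon>)\<^sup>2 / (\<kappa>\<epsilon> * (1 - \<kappa>\<epsilon>))"
    unfolding alignment_rate_def using frac_le[OF _ n(2) d(4,3)] by simp
qed

section \<open>Derivatives of distance and bearing along a trajectory\<close>

context
  fixes \<kappa>r \<kappa>\<epsilon> \<theta>0 :: real and xg x0 :: "real ^ 2"
    and x :: "real \<Rightarrow> real ^ 2" and \<theta> :: "real \<Rightarrow> real"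
  assumes \<kappa>r: "\<kappa>r > 0" and \<kappa>\<epsilon>: "0 < \<kappa>\<epsilon>" "\<kappa>\<epsilon> < 1"
    and traj: "unicycle_trajectory (headway_linear_velocity \<kappa>r \<kappa>\<epsilon> xg)
           (headway_angular_velocity \<kappa>r \<kappa>\<epsilon> xg) x0 \<theta>0 x \<theta>"
begin

abbreviation (input) "v t \<equiv> headway_linear_velocity \<kappa>r \<kappa>\<epsilon> xg (x t) (\<theta> t)"
abbreviation (input) "\<omega> t \<equiv> headway_angular_velocity \<kappa>r \<kappa>\<epsilon> xg (x t) (\<theta> t)"
abbreviation (input) "R t \<equiv> (xg - x t) \<bullet> (xg - x t)"
abbreviation (input) "c t \<equiv> bearing_cos xg (x t) (\<theta> t)"

lemma theta_deriv:
  "0 \<le> t \<Longrightarrow> (\<theta> has_real_derivative \<omega> t) (at t within {0..})"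
  using traj unfolding unicycle_trajectory_def by blast

lemma goal_offset_deriv:
  assumes "0 \<le> t"
  shows "((\<lambda>t. (xg - x t) $ i) has_real_derivative - v t * heading (\<theta> t) $ i) (at t within {0..})"
proof -
  have "(x has_vector_derivative v t *\<^sub>R heading (\<theta> t)) (at t within {0..})"
    using traj assms unfolding unicycle_trajectory_def by blast
  then have "((\<lambda>t. x t $ i) has_vector_derivative (v t *\<^sub>R heading (\<theta> t)) $ i) (at t within {0..})"
    by (rule bounded_linear.has_vector_derivative[OF bounded_linear_vec_nth])
  then have "((\<lambda>t. x t $ i) has_real_derivative v t * heading (\<theta> t) $ i) (at t within {0..})"
    by (simp add: has_real_derivative_iff_has_vector_derivative)
  then show ?thesis
    by (auto intro!: derivative_eq_intros)
qed

lemma heading_offset_deriv: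
  assumes "0 \<le> t"
  shows "((\<lambda>t. heading (\<theta> t) \<bullet> (xg - x t)) has_real_derivative
      \<omega> t * (heading_normal (\<theta> t) \<bullet> (xg - x t)) - v t) (at t within {0..})"
proof -
  \<comment> \<open>Translation contributes \<open>- v t\<close> times the squared length of the
    heading; this identity collapses that length to \<open>1\<close>.\<close>
  have "v t = v t * (cos (\<theta> t))\<^sup>2 + v t * (sin (\<theta> t))\<^sup>2"
    by (simp flip: distrib_left)
  then show ?thesis
    unfolding inner_heading inner_heading_normal
    by (auto intro!: derivative_eq_intros theta_deriv[OF assms] goal_offset_deriv[OF assms]
        simp: heading_def algebra_simps power2_eq_square simp del: vector_minus_component)
qed

lemma square_distance_deriv:
  assumes "0 \<le> t"
  shows "((\<lambda>t. R t) has_real_derivative - 2 * \<kappa>r * radial_rate \<kappa>\<epsilon> (c t) * R t) (at t within {0..})"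
proof -
  have "((\<lambda>t. ((xg - x t) $ 1) ^ 2 + ((xg - x t) $ 2) ^ 2) has_real_derivative
      - 2 * (v t * (heading (\<theta> t) \<bullet> (xg - x t)))) (at t within {0..})"
    unfolding inner_heading
    by (auto intro!: derivative_eq_intros goal_offset_deriv[OF assms]
        simp: heading_def algebra_simps simp del: vector_minus_component)
  moreover have "v t * (heading (\<theta> t) \<bullet> (xg - x t)) = \<kappa>r * radial_rate \<kappa>\<epsilon> (c t) * R t"
    \<comment> \<open>At the goal both sides vanish, so the formula for the derivative holds at
      every time, without a side condition.\<close>
    by (cases "x t = xg")
      (auto simp: headway_linear_velocity_def bearing_cos_def radial_rate_def goal_direction_def
        norm_eq_sqrt_inner divide_simps)
  ultimately show ?thesis
    by (simp add: inner_vec_def sum_2 power2_eq_square mult.assoc)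
qed

text \<open>Apply the quotient rule to \<open>c = p / sqrt R\<close>. Since \<open>v\<close> is
  proportional to the distance and \<open>\<omega>\<close> is independent of it, the distance
  cancels and an autonomous scalar equation for \<open>c\<close> remains.\<close>

lemma bearing_cos_deriv:
  assumes "0 \<le> t" "x t \<noteq> xg"
  shows "((\<lambda>t. c t) has_real_derivative
    \<kappa>r * (1 - (c t)\<^sup>2) * alignment_rate \<kappa>\<epsilon> (c t)) (at t within {0..})"
proof -
  define r where "r = norm (xg - x t)"
  define q where "q = heading_normal (\<theta> t) \<bullet> (xg - x t)"
  define p where "p = heading (\<theta> t) \<bullet> (xg - x t)"
  have r: "r > 0" "R t = r\<^sup>2" "R t > 0" "sqrt (R t) = r"
    using assms by (simp_all add: r_def power2_norm_eq_inner norm_eq_sqrt_inner)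
  have c: "c t = p / r"
    by (simp add: p_def r_def bearing_cos_def goal_direction_def divide_inverse mult.commute)
  have pq: "p\<^sup>2 + q\<^sup>2 = r\<^sup>2"
    using inner_heading_square_sum r(2) unfolding p_def q_def by simp
  have den: "1 - \<kappa>\<epsilon> * c t > 0"
    using headway_denominator_bounds(1)[OF \<kappa>\<epsilon> bearing_cos_bounds, of xg "x t" "\<theta> t"] \<kappa>\<epsilon> by linarith
  have v: "v t = \<kappa>r * r * (c t - \<kappa>\<epsilon>) / (1 - \<kappa>\<epsilon> * c t)"
    using assms by (simp add: headway_linear_velocity_def bearing_cos_def r_def)
  have \<omega>: "\<omega> t = \<kappa>r / \<kappa>\<epsilon> * (q / r)"
    using assms by (simp add: headway_angular_velocity_def q_def r_def goal_direction_def divide_inverse)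
  have R': "((\<lambda>t. R t) has_real_derivative - 2 * v t * p) (at t within {0..})"
  proof (rule DERIV_cong[OF square_distance_deriv[OF assms(1)]])
    show "- 2 * \<kappa>r * radial_rate \<kappa>\<epsilon> (c t) * R t = - 2 * v t * p"
      unfolding v radial_rate_def r(2) using c r den by (simp add: power2_eq_square)
  qed
  have "((\<lambda>t. (heading (\<theta> t) \<bullet> (xg - x t)) / sqrt (R t)) has_real_derivative
      ((\<omega> t * q - v t) * r - p * (- v t * p / r)) / (r * r)) (at t within {0..})"
    using r by (auto intro!: derivative_eq_intros heading_offset_deriv[OF assms(1), folded q_def] R'
       simp: p_def[symmetric] field_simps)
  moreover have "((\<omega> t * q - v t) * r - p * (- v t * p / r)) / (r * r)
     = \<kappa>r * (1 - (c t)\<^sup>2) * alignment_rate \<kappa>\<epsilon> (c t)"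
  proof -
    have p: "p = r * c t" using r c by simp
    have q2: "q\<^sup>2 = r\<^sup>2 * (1 - (c t)\<^sup>2)"
      using pq unfolding p by (simp add: algebra_simps power_mult_distrib)
    have "((\<omega> t * q - v t) * r - p * (- v t * p / r)) / (r * r)
       = \<kappa>r / \<kappa>\<epsilon> * (q\<^sup>2 / r\<^sup>2) - v t / r * (1 - (c t)\<^sup>2)"
      unfolding \<omega> p using r \<kappa>\<epsilon> by (simp add: field_simps power2_eq_square)
    also have "\<dots> = \<kappa>r * (1 - (c t)\<^sup>2) * (1 / \<kappa>\<epsilon> - (c t - \<kappa>\<epsilon>) / (1 - \<kappa>\<epsilon> * c t))"
    proof -
      \<comment> \<open>Naming the fraction keeps the simplifier from expanding it, so that only a
        polynomial identity is left.\<close>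
      define y where "y = (c t - \<kappa>\<epsilon>) / (1 - \<kappa>\<epsilon> * c t)"
      have eqs: "q\<^sup>2 / r\<^sup>2 = 1 - (c t)\<^sup>2" "v t / r = \<kappa>r * y"
        unfolding q2 v y_def using r(1) by simp_all
      show ?thesis
        unfolding eqs y_def[symmetric] by (simp add: algebra_simps)
    qed
    also have "1 / \<kappa>\<epsilon> - (c t - \<kappa>\<epsilon>) / (1 - \<kappa>\<epsilon> * c t) = alignment_rate \<kappa>\<epsilon> (c t)"
      unfolding alignment_rate_def using den \<kappa>\<epsilon> by (simp add: field_simps power2_eq_square)
    finally show ?thesis .
  qed
  ultimately show ?thesis
    by (simp add: bearing_cos_def goal_direction_def norm_eq_sqrt_inner divide_inverse mult.commute)
qed

section \<open>Invariance and convergence of the scalar quantities\<close>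

lemma square_distance_rate_bound:
  "\<bar>- 2 * \<kappa>r * radial_rate \<kappa>\<epsilon> (c t) * R t\<bar> \<le> 4 * \<kappa>r / (1 - \<kappa>\<epsilon>) * R t"
proof -
  have "2 * \<kappa>r * \<bar>radial_rate \<kappa>\<epsilon> (c t)\<bar> * R t \<le> 2 * \<kappa>r * (2 / (1 - \<kappa>\<epsilon>)) * R t"
    using \<kappa>r radial_rate_bound[OF \<kappa>\<epsilon> bearing_cos_bounds]
    by (intro mult_right_mono mult_left_mono) auto
  then show ?thesis using \<kappa>r by (simp add: abs_mult)
qed

lemma goal_stays:
  assumes "x 0 = xg" "0 \<le> t"
  shows "x t = xg"
proof -
  have "R t \<le> R 0 * exp (4 * \<kappa>r / (1 - \<kappa>\<epsilon>) * (t - 0))"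
  proof (rule exp_bound_of_deriv_le[OF square_distance_deriv])
    show "- 2 * \<kappa>r * radial_rate \<kappa>\<epsilon> (c s) * R s \<le> 4 * \<kappa>r / (1 - \<kappa>\<epsilon>) * R s" for s
      using square_distance_rate_bound[of s] by linarith
  qed (use assms in auto)
  then have "R t \<le> 0" using assms(1) by simp
  then have "R t = 0" by (intro antisym) simp_all
  then show ?thesis by simp
qed

text \<open>The lower Gronwall bound keeps \<open>R\<close> positive at all times, which makes
  \<open>bearing_cos_deriv\<close> applicable along the whole trajectory.\<close>

lemma goal_not_reached:
  assumes "x 0 \<noteq> xg" "0 \<le> t"
  shows "x t \<noteq> xg"
proof -
  have "R 0 * exp (- (4 * \<kappa>r / (1 - \<kappa>\<epsilon>)) * (t - 0)) \<le> R t"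
  proof (rule exp_bound_of_deriv_ge[OF square_distance_deriv])
    show "- (4 * \<kappa>r / (1 - \<kappa>\<epsilon>)) * R s \<le> - 2 * \<kappa>r * radial_rate \<kappa>\<epsilon> (c s) * R s" for s
      using square_distance_rate_bound[of s] by linarith
  qed (use assms in auto)
  moreover have "0 < R 0 * exp (- (4 * \<kappa>r / (1 - \<kappa>\<epsilon>)) * (t - 0))"
    using assms by simp
  ultimately show ?thesis by auto
qed

text \<open>The factor \<open>1 + c\<close> of \<open>1 - c\<^sup>2\<close> makes the derivative of
  \<open>1 + c\<close> at most a constant multiple of \<open>1 + c\<close>, so a zero initial value
  persists. The constant comes from \<open>1 - c \<le> 2\<close> and the upper bound
  \<open>A\<close> on \<open>alignment_rate\<close>.\<close>

lemma facing_away_stays: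
  assumes "x 0 \<noteq> xg" "c 0 = - 1" "0 \<le> t"
  shows "c t = - 1"
proof -
  define A where "A = (1 + \<kappa>\<epsilon>)\<^sup>2 / (\<kappa>\<epsilon> * (1 - \<kappa>\<epsilon>))"
  have A: "0 \<le> A" using \<kappa>\<epsilon> by (simp add: A_def)
  have "1 + c t \<le> (1 + c 0) * exp ((\<kappa>r * (2 * A)) * (t - 0))"
  proof (rule exp_bound_of_deriv_le[OF _ _ \<open>0 \<le> t\<close>])
    fix s :: real assume s: "0 \<le> s"
    show "((\<lambda>s. 1 + c s) has_real_derivative
        \<kappa>r * (1 - (c s)\<^sup>2) * alignment_rate \<kappa>\<epsilon> (c s)) (at s within {0..})"
      using bearing_cos_deriv[OF s goal_not_reached[OF assms(1) s]]
      by (auto intro!: derivative_eq_intros)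
    have b: "0 \<le> 1 + c s" "0 \<le> 1 - c s" "1 - c s \<le> 2"
      using bearing_cos_bounds[of xg "x s" "\<theta> s"] by auto
    have "\<kappa>r * (1 + c s) * ((1 - c s) * alignment_rate \<kappa>\<epsilon> (c s)) \<le> \<kappa>r * (1 + c s) * (2 * A)"
    proof (rule mult_left_mono)
      have "(1 - c s) * alignment_rate \<kappa>\<epsilon> (c s) \<le> (1 - c s) * A"
        unfolding A_def using b alignment_rate_bounds(2)[OF \<kappa>\<epsilon> bearing_cos_bounds]
        by (intro mult_left_mono) auto
      also have "\<dots> \<le> 2 * A" using b A by (intro mult_right_mono) auto
      finally show "(1 - c s) * alignment_rate \<kappa>\<epsilon> (c s) \<le> 2 * A" .
    qed (use \<kappa>r b in simp)
    then show "\<kappa>r * (1 - (c s)\<^sup>2) * alignment_rate \<kappa>\<epsilon> (c s) \<le> \<kappa>r * (2 * A) * (1 + c s)"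
      by (simp add: power2_eq_square algebra_simps)
  qed
  then show ?thesis
    using assms bearing_cos_bounds(1)[of xg "x t" "\<theta> t"] by simp
qed

lemma alignment_exponential:
  assumes "x 0 \<noteq> xg" "c 0 \<noteq> - 1"
  obtains k where "k > 0" "\<And>t. 0 \<le> t \<Longrightarrow> 1 - c t \<le> (1 - c 0) * exp (- k * t)"
proof -
  define A where "A = (1 - \<kappa>\<epsilon>)\<^sup>2 / (\<kappa>\<epsilon> * (1 + \<kappa>\<epsilon>))"
  have A: "0 < A" using \<kappa>\<epsilon> by (simp add: A_def)
  have A_le: "A \<le> alignment_rate \<kappa>\<epsilon> (c s)" for s
    unfolding A_def by (rule alignment_rate_bounds(1)[OF \<kappa>\<epsilon> bearing_cos_bounds])
  have b: "0 \<le> 1 + c s" "0 \<le> 1 - c s" for s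
    using bearing_cos_bounds[of xg "x s" "\<theta> s"] by auto
  have deriv: "((\<lambda>s. 1 - c s) has_real_derivative
      - (\<kappa>r * (1 - (c s)\<^sup>2) * alignment_rate \<kappa>\<epsilon> (c s))) (at s within {0..})" if s: "0 \<le> s" for s
    using bearing_cos_deriv[OF s goal_not_reached[OF assms(1) s]]
    by (auto intro!: derivative_eq_intros)
  \<comment> \<open>Any lower bound \<open>m\<close> on \<open>1 + c\<close> gives the decay rate
    \<open>\<kappa>r * m * A\<close> for \<open>1 - c\<close>. It is used twice:
    \<open>m = 0\<close> shows that \<open>c\<close> never drops below its initial value, which then
    justifies the positive choice \<open>m = 1 + c 0\<close>.\<close>
  have rate: "- (\<kappa>r * (1 - (c s)\<^sup>2) * alignment_rate \<kappa>\<epsilon> (c s)) \<le> - (\<kappa>r * m * A) * (1 - c s)"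
    if "0 \<le> m" "m \<le> 1 + c s" for s m
  proof -
    have "(\<kappa>r * (1 - c s)) * (m * A) \<le> (\<kappa>r * (1 - c s)) * ((1 + c s) * alignment_rate \<kappa>\<epsilon> (c s))"
      using that A A_le[of s] b[of s] \<kappa>r by (intro mult_left_mono mult_mono) auto
    then show ?thesis by (simp add: power2_eq_square algebra_simps)
  qed
  have mono: "c 0 \<le> c t" if "0 \<le> t" for t
  proof -
    have "1 - c t \<le> (1 - c 0) * exp (- (\<kappa>r * 0 * A) * (t - 0))"
      using b by (intro exp_bound_of_deriv_le[OF deriv rate that]) auto
    then show ?thesis by simp
  qed
  show thesis
  proof (rule that[of "\<kappa>r * (1 + c 0) * A"])
    show "0 < \<kappa>r * (1 + c 0) * A"
      using \<kappa>r A b(1)[of 0] assms(2) by simp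
    show "1 - c t \<le> (1 - c 0) * exp (- (\<kappa>r * (1 + c 0) * A) * t)" if "0 \<le> t" for t
      using exp_bound_of_deriv_le[OF deriv rate[OF b(1)[of 0]] that] mono by simp
  qed
qed

text \<open>The bearing cosine is constantly \<open>- 1\<close> or tends to \<open>1\<close>, and
  \<open>radial_rate\<close> equals \<open>1\<close> at both values: facing away, the unicycle
  reverses straight towards the goal.\<close>

lemma radial_rate_eventually:
  assumes "x 0 \<noteq> xg"
  obtains T where "0 \<le> T" "\<And>t. T \<le> t \<Longrightarrow> 1 / 2 \<le> radial_rate \<kappa>\<epsilon> (c t)"
proof (cases "c 0 = - 1")
  case True
  have "radial_rate \<kappa>\<epsilon> (c t) = 1" if "0 \<le> t" for t
    using facing_away_stays[OF assms True that] \<kappa>\<epsilon> by (simp add: radial_rate_def)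
  then show thesis by (intro that[of 0]) auto
next
  case False
  obtain k where k: "k > 0" "\<And>t. 0 \<le> t \<Longrightarrow> 1 - c t \<le> (1 - c 0) * exp (- k * t)"
    using alignment_exponential[OF assms False] by blast
  have "((\<lambda>t. (1 - c 0) * exp (- k * t)) \<longlongrightarrow> 0) at_top"
    using k(1) by real_asymp
  then have lim: "((\<lambda>t. 1 - c t) \<longlongrightarrow> 0) at_top"
  proof (rule tendsto_sandwich[rotated 2, OF tendsto_const])
    show "\<forall>\<^sub>F t in at_top. 0 \<le> 1 - c t"
      using bearing_cos_bounds(2) by simp
    show "\<forall>\<^sub>F t in at_top. 1 - c t \<le> (1 - c 0) * exp (- k * t)"
      using eventually_ge_at_top[of 0] by eventually_elim (rule k(2))
  qed
  have "((\<lambda>t. c t) \<longlongrightarrow> 1) at_top"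
    using tendsto_diff[OF tendsto_const[of 1] lim] by simp
  then have "((\<lambda>t. radial_rate \<kappa>\<epsilon> (c t)) \<longlongrightarrow> 1 * (1 - \<kappa>\<epsilon>) / (1 - \<kappa>\<epsilon> * 1)) at_top"
    unfolding radial_rate_def using \<kappa>\<epsilon> by (intro tendsto_intros) auto
  then have "((\<lambda>t. radial_rate \<kappa>\<epsilon> (c t)) \<longlongrightarrow> 1) at_top"
    using \<kappa>\<epsilon> by simp
  \<comment> \<open>Any threshold in (0, 1) would do; \<open>1 / 2\<close> makes the final decay
    rate of \<open>R\<close> equal to \<open>\<kappa>r\<close>.\<close>
  then have "\<forall>\<^sub>F t in at_top. 1 / 2 < radial_rate \<kappa>\<epsilon> (c t)"
    by (rule order_tendstoD) simp
  then obtain T where "\<And>t. T \<le> t \<Longrightarrow> 1 / 2 < radial_rate \<kappa>\<epsilon> (c t)"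
    by (auto simp: eventually_at_top_linorder)
  then show thesis by (intro that[of "max 0 T"]) (auto intro: less_imp_le)
qed

lemma position_tendsto_goal: "(x \<longlongrightarrow> xg) at_top"
proof (cases "x 0 = xg")
  case True
  have "\<forall>\<^sub>F t in at_top. x t = xg"
    using eventually_ge_at_top[of 0] by eventually_elim (rule goal_stays[OF True])
  then show ?thesis by (rule tendsto_eventually)
next
  case False
  obtain T where T: "0 \<le> T" "\<And>t. T \<le> t \<Longrightarrow> 1 / 2 \<le> radial_rate \<kappa>\<epsilon> (c t)"
    using radial_rate_eventually[OF False] by blast
  \<comment> \<open>The comparison starts at \<open>T\<close>, since \<open>R\<close> may increase
    before that time.\<close>
  have bound: "R t \<le> R T * exp (- \<kappa>r * (t - T))" if "T \<le> t" for t
  proof (rule exp_bound_of_deriv_le[OF _ _ that])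
    fix s assume s: "T \<le> s"
    show "((\<lambda>t. R t) has_real_derivative - 2 * \<kappa>r * radial_rate \<kappa>\<epsilon> (c s) * R s) (at s within {T..})"
      by (rule DERIV_subset[OF square_distance_deriv]) (use s T in auto)
    have "2 * \<kappa>r * (1 / 2) * R s \<le> 2 * \<kappa>r * radial_rate \<kappa>\<epsilon> (c s) * R s"
      using T(2)[OF s] \<kappa>r by (intro mult_right_mono mult_left_mono) auto
    then show "- 2 * \<kappa>r * radial_rate \<kappa>\<epsilon> (c s) * R s \<le> - \<kappa>r * R s" by simp
  qed
  have "((\<lambda>t. R T * exp (- \<kappa>r * (t - T))) \<longlongrightarrow> 0) at_top"
    using \<kappa>r by real_asymp
  then have "((\<lambda>t. R t) \<longlongrightarrow> 0) at_top"
  proof (rule tendsto_sandwich[rotated 2, OF tendsto_const])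
    show "\<forall>\<^sub>F t in at_top. R t \<le> R T * exp (- \<kappa>r * (t - T))"
      using eventually_ge_at_top[of T] by eventually_elim (rule bound)
  qed simp
  then have "((\<lambda>t. norm (xg - x t)) \<longlongrightarrow> 0) at_top"
    unfolding norm_eq_sqrt_inner using tendsto_real_sqrt[of "\<lambda>t. R t" 0] by simp
  then show ?thesis
    unfolding tendsto_dist_iff[of x] dist_norm by (simp only: norm_minus_commute)
qed

end

theorem proposition1:
  fixes \<kappa>r \<kappa>\<epsilon> \<theta>0 :: real
    and xg x0 :: "real ^ 2"
    and x :: "real \<Rightarrow> real ^ 2"
    and \<theta> :: "real \<Rightarrow> real"
  assumes "\<kappa>r > 0"
    and "0 < \<kappa>\<epsilon>" and "\<kappa>\<epsilon> < 1"
    and "\<theta>0 \<in> {- pi..<pi}"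
    and "unicycle_trajectory (headway_linear_velocity \<kappa>r \<kappa>\<epsilon> xg)
           (headway_angular_velocity \<kappa>r \<kappa>\<epsilon> xg) x0 \<theta>0 x \<theta>"
  shows "(x \<longlongrightarrow> xg) at_top"
  using assms(1-3,5) by (rule position_tendsto_goal)

end
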